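(* Let $\varphi:[\tau_1,\tau_2]\to[\tau_1,\tau_2]$ and $\psi:[\sigma_1,\sigma_2]\to[\sigma_1,\sigma_2]$ be two differentiable involutions ($\tau_1<\tau_2$, $\sigma_1<\sigma_2$), and let $t_0$ and $s_0$ be the unique fixed points of $\varphi$ and $\psi$ respectively. Then there exists an orientation-preserving diffeomorphism $f:[\sigma_1,\sigma_2]\to[\tau_1,\tau_2]$ such that $f(\psi(s))=\varphi(f(s))$ for all $s\in[\sigma_1,\sigma_2]$.
   Context: An involution is a function $\varphi$ from a set to itself, different from the identity, with $\varphi(\varphi(t))=t$ for all $t$. A continuous involution of an interval is decreasing and has exactly one fixed point. A diffeomorphism here is a differentiable bijection with differentiable inverse; orientation-preserving means increasing. *)

theory Defs
  imports "HOL-Analysis.Analysis"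
begin

(* Maps between intervals are total functions of which only the values on the domain S matter.
   Differentiability is differentiable_on, hence one-sided at the endpoints of a closed interval. *)

definition involution_on :: "'a set \<Rightarrow> ('a \<Rightarrow> 'a) \<Rightarrow> bool" where
  "involution_on S \<phi> \<longleftrightarrow>
     \<phi> \<in> S \<rightarrow> S \<and> (\<exists>t\<in>S. \<phi> t \<noteq> t) \<and> (\<forall>t\<in>S. \<phi> (\<phi> t) = t)"

(* Meaningful only when there is exactly one fixed point in S, as there is for a continuous
   involution of a compact interval. *)
definition fixed_point_on :: "'a set \<Rightarrow> ('a \<Rightarrow> 'a) \<Rightarrow> 'a" where
  "fixed_point_on S \<phi> = (THE t. t \<in> S \<and> \<phi> t = t)"

definition diffeomorphism_on :: "real set \<Rightarrow> real set \<Rightarrow> (real \<Rightarrow> real) \<Rightarrow> bool" where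
  "diffeomorphism_on S T f \<longleftrightarrow>
     bij_betw f S T \<and> f differentiable_on S \<and> inv_into S f differentiable_on T"

end

theory Submission
  imports Defs
begin

text \<open>
  For an involution \<open>\<phi>\<close> the map \<open>h t = t - \<phi> t\<close> satisfies \<open>h (\<phi> t) = - h t\<close>, so it conjugates
  \<open>\<phi>\<close> to the reflection of a symmetric interval. Since \<open>\<phi>\<close> is decreasing, \<open>h\<close> expands
  distances; hence its derivative does not vanish and \<open>h\<close> is a diffeomorphism. The conjugacy between
  \<open>\<psi>\<close> and \<open>\<phi>\<close> is obtained by linearising both and rescaling in between.
\<close>

text \<open>The derivative within \<open>S\<close> depends only on values on \<open>S\<close>. This
  allows an \<open>inv_into\<close> to be replaced by a formula that agrees with it only
  there.\<close>

lemma differentiable_on_cong: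
  assumes "f differentiable_on S" and "\<And>x. x \<in> S \<Longrightarrow> g x = f x"
  shows "g differentiable_on S"
  using assms has_derivative_transform unfolding differentiable_on_def differentiable_def by metis

lemma diffeomorphism_on_compose:
  assumes f: "diffeomorphism_on S T f" and g: "diffeomorphism_on T U g"
  shows "diffeomorphism_on S U (g \<circ> f)"
proof -
  have bf: "bij_betw f S T" and bg: "bij_betw g T U"
    using f g by (simp_all add: diffeomorphism_on_def)
  have "(inv_into S f \<circ> inv_into T g) differentiable_on U"
    using f g bij_betw_imp_surj_on[OF bij_betw_inv_into[OF bg]]
      differentiable_on_compose[of "inv_into T g" U "inv_into S f"]
    by (simp add: o_def diffeomorphism_on_def)
  moreover have "inv_into S (g \<circ> f) x = (inv_into S f \<circ> inv_into T g) x" if "x \<in> U" for x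
    using that bf bg inv_into_comp[of g f S x] by (simp add: bij_betw_def)
  ultimately have "inv_into S (g \<circ> f) differentiable_on U"
    by (rule differentiable_on_cong)
  moreover have "(g \<circ> f) differentiable_on S"
    using f g bij_betw_imp_surj_on[OF bf] differentiable_on_compose[of f S g]
    by (simp add: o_def diffeomorphism_on_def)
  ultimately show ?thesis
    using bij_betw_trans[OF bf bg] by (simp add: diffeomorphism_on_def)
qed

lemma diffeomorphism_on_inv_into:
  assumes "diffeomorphism_on S T f"
  shows "diffeomorphism_on T S (inv_into S f)"
proof -
  have bf: "bij_betw f S T" and df: "f differentiable_on S"
    using assms by (simp_all add: diffeomorphism_on_def)
  have "inv_into T (inv_into S f) differentiable_on S"
    using df by (rule differentiable_on_cong) (rule inv_into_inv_into_eq[OF bf])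
  then show ?thesis
    using assms bij_betw_inv_into[OF bf] by (simp add: diffeomorphism_on_def)
qed

text \<open>Adjusts the lengths of the symmetric intervals on which the two linearised involutions
  act.\<close>

lemma diffeomorphism_on_scale:
  fixes c L :: real
  assumes "0 < c"
  shows "diffeomorphism_on {-L..L} {-(c * L)..c * L} (\<lambda>x. c * x)"
proof -
  have inj: "inj_on (\<lambda>x. c * x) {-L..L}"
    using assms by (simp add: inj_on_def)
  have img: "(\<lambda>x. c * x) ` {-L..L} = {-(c * L)..c * L}"
    using image_mult_atLeastAtMost[OF assms, of "-L" L] by simp
  have "(\<lambda>y. inverse c * y) differentiable_on {-(c * L)..c * L}"
    by (simp add: differentiable_on_def)
  moreover have "inv_into {-L..L} (\<lambda>x. c * x) y = inverse c * y" if y: "y \<in> {-(c * L)..c * L}" for y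
  proof -
    obtain x where x: "x \<in> {-L..L}" "y = c * x"
      using y unfolding img[symmetric] by (rule imageE)
    show ?thesis
      using inv_into_f_f[OF inj x(1)] assms by (simp add: x(2))
  qed
  ultimately have "inv_into {-L..L} (\<lambda>x. c * x) differentiable_on {-(c * L)..c * L}"
    by (rule differentiable_on_cong)
  then show ?thesis
    using inj img by (simp add: diffeomorphism_on_def bij_betw_def differentiable_on_def)
qed

text \<open>Strict monotonicity alone would allow a zero derivative, as for the cube at 0, and then
  the inverse fails to be differentiable. Expansion keeps every difference quotient at least 1,
  hence the derivative as well.\<close>

lemma expanding_imp_diffeomorphism_on:
  fixes h :: "real \<Rightarrow> real"
  assumes "a < b" and diff: "h differentiable_on {a..b}"
    and exp: "\<And>x y. x \<in> {a..b} \<Longrightarrow> y \<in> {a..b} \<Longrightarrow> x < y \<Longrightarrow> y - x \<le> h y - h x"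
  shows "diffeomorphism_on {a..b} {h a..h b} h"
proof -
  let ?S = "{a..b}"
  have mono: "strict_mono_on ?S h"
    using exp by (force intro!: strict_mono_onI)
  have inj: "inj_on h ?S"
    by (rule strict_mono_on_imp_inj_on[OF mono])
  have cont: "continuous_on ?S h"
    by (rule differentiable_imp_continuous_on[OF diff])
  have img: "h ` ?S = {h a..h b}"
  proof
    show "h ` ?S \<subseteq> {h a..h b}"
      using strict_mono_on_leD[OF mono] by auto
    show "{h a..h b} \<subseteq> h ` ?S"
      using IVT'[of h a _ b] cont \<open>a < b\<close> by fastforce
  qed
  have left: "inv_into ?S h (h x) = x" if "x \<in> ?S" for x
    using inj that by simp
  \<comment> \<open>Compactness of the interval makes the inverse continuous, which the inverse
    function rule used below requires.\<close>
  have cont_inv: "continuous_on (h ` ?S) (inv_into ?S h)"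
    using continuous_on_inv[OF cont] left by auto
  have "inv_into ?S h differentiable (at (h x) within h ` ?S)" if x: "x \<in> ?S" for x
  proof -
    obtain d where d: "(h has_field_derivative d) (at x within ?S)"
      using diff x unfolding differentiable_on_def real_differentiable_def by blast
    \<comment> \<open>The bound on the quotients passes to the limit. Since \<open>a < b\<close>,
      the point \<open>x\<close> is a limit point of the interval, so that this limit is not
      vacuous, even at an endpoint.\<close>
    have "1 \<le> d"
    proof (rule tendsto_lowerbound)
      show "((\<lambda>y. (h y - h x) / (y - x)) \<longlongrightarrow> d) (at x within ?S)"
        using d by (simp add: has_field_derivative_iff)
      show "at x within ?S \<noteq> bot"
        using x \<open>a < b\<close> by (simp add: trivial_limit_within islimpt_Icc)
      have "1 \<le> (h y - h x) / (y - x)" if "y \<in> ?S" "y \<noteq> x" for y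
        using exp[of x y] exp[of y x] x that by (cases "x < y") (auto simp: divide_simps)
      then show "\<forall>\<^sub>F y in at x within ?S. 1 \<le> (h y - h x) / (y - x)"
        by (auto simp: eventually_at_filter)
    qed
    then have "(\<lambda>y. inverse d * y) \<circ> (\<lambda>y. d * y) = id"
      by (auto simp: fun_eq_iff)
    moreover have "linear (\<lambda>y. inverse d * y)"
      by (simp add: linear_times)
    moreover have "continuous (at (h x) within h ` ?S) (inv_into ?S h)"
      using cont_inv x by (simp add: continuous_on_eq_continuous_within)
    ultimately have "(inv_into ?S h has_derivative (\<lambda>y. inverse d * y)) (at (h x) within h ` ?S)"
      using d x left
      by (intro has_derivative_inverse_within[where f' = "\<lambda>y. d * y"])
        (auto simp: has_field_derivative_def)
    then show ?thesis
      by (rule differentiableI)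
  qed
  then have "inv_into ?S h differentiable_on h ` ?S"
    by (auto simp: differentiable_on_def)
  then show ?thesis
    using inj img diff by (simp add: diffeomorphism_on_def bij_betw_def)
qed

text \<open>A continuous injection of an interval is strictly monotone, so it suffices to exclude
  the increasing case.\<close>

lemma continuous_involution_decreasing:
  fixes \<phi> :: "real \<Rightarrow> real"
  assumes inv: "involution_on {a..b} \<phi>" and cont: "continuous_on {a..b} \<phi>"
  shows "strict_antimono_on {a..b} \<phi>"
proof -
  have maps: "\<phi> t \<in> {a..b}" and invol: "\<phi> (\<phi> t) = t" if "t \<in> {a..b}" for t
    using inv that by (auto simp: involution_on_def)
  have "inj_on \<phi> {a..b}"
    by (metis inj_on_inverseI invol)
  moreover have "\<not> strict_mono_on {a..b} \<phi>"
  proof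
    assume mono: "strict_mono_on {a..b} \<phi>"
    \<comment> \<open>If \<open>t < \<phi> t\<close>, applying the increasing \<phi> gives
      \<open>\<phi> t < t\<close>; the other inequality is symmetric. Thus an increasing involution
      would be the identity.\<close>
    have "\<phi> t = t" if "t \<in> {a..b}" for t
      using strict_mono_onD[OF mono, of t "\<phi> t"] strict_mono_onD[OF mono, of "\<phi> t" t]
        maps[OF that] invol[OF that] that by (metis linorder_neqE order_less_asym)
    then show False
      using inv by (auto simp: involution_on_def)
  qed
  ultimately show ?thesis
    using injective_eq_monotone_map[of "{a..b}" \<phi>] cont by (auto simp: is_interval_cc)
qed

text \<open>For \<open>x < y\<close> the increment of \<open>t - \<phi> t\<close> is
  \<open>(y - x) + (\<phi> x - \<phi> y)\<close>, and the second summand is positive because \<phi>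
  decreases.\<close>

lemma involution_linearisation:
  fixes \<phi> :: "real \<Rightarrow> real"
  assumes "a < b" and inv: "involution_on {a..b} \<phi>" and diff: "\<phi> differentiable_on {a..b}"
  shows "diffeomorphism_on {a..b} {- (b - a)..b - a} (\<lambda>t. t - \<phi> t)"
    and "strict_mono_on {a..b} (\<lambda>t. t - \<phi> t)"
proof -
  have maps: "\<phi> t \<in> {a..b}" and invol: "\<phi> (\<phi> t) = t" if "t \<in> {a..b}" for t
    using inv that by (auto simp: involution_on_def)
  have anti: "strict_antimono_on {a..b} \<phi>"
    by (rule continuous_involution_decreasing[OF inv differentiable_imp_continuous_on[OF diff]])
  then have dec: "\<phi> y < \<phi> x" if "x \<in> {a..b}" "y \<in> {a..b}" "x < y" for x y
    using that by (auto simp: monotone_on_def)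
  \<comment> \<open>If \<open>a < \<phi> b\<close>, then applying \<phi> gives
    \<open>b < \<phi> a\<close>, outside the interval; likewise \<open>\<phi> a < b\<close> would
    give \<open>\<phi> b < a\<close>. The exchange of endpoints makes the image interval symmetric
    about 0.\<close>
  have ends: "\<phi> a = b" "\<phi> b = a"
    using dec[of a "\<phi> b"] dec[of "\<phi> a" b] maps[of a] maps[of b] invol[of a] invol[of b] \<open>a < b\<close>
    by fastforce+
  have "diffeomorphism_on {a..b} {a - \<phi> a..b - \<phi> b} (\<lambda>t. t - \<phi> t)"
  proof (rule expanding_imp_diffeomorphism_on[OF \<open>a < b\<close>])
    show "(\<lambda>t. t - \<phi> t) differentiable_on {a..b}"
      using diff by (intro derivative_intros)
  qed (use dec in fastforce)
  then show "diffeomorphism_on {a..b} {- (b - a)..b - a} (\<lambda>t. t - \<phi> t)"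
    by (simp add: ends)
  show "strict_mono_on {a..b} (\<lambda>t. t - \<phi> t)"
    using dec by (force intro!: strict_mono_onI)
qed

theorem mainTheorem3:
  fixes \<phi> \<psi> :: "real \<Rightarrow> real" and \<tau>\<^sub>1 \<tau>\<^sub>2 \<sigma>\<^sub>1 \<sigma>\<^sub>2 t\<^sub>0 s\<^sub>0 :: real
  assumes "\<tau>\<^sub>1 < \<tau>\<^sub>2" and "\<sigma>\<^sub>1 < \<sigma>\<^sub>2"
    and "involution_on {\<tau>\<^sub>1..\<tau>\<^sub>2} \<phi>" and "\<phi> differentiable_on {\<tau>\<^sub>1..\<tau>\<^sub>2}"
    and "involution_on {\<sigma>\<^sub>1..\<sigma>\<^sub>2} \<psi>" and "\<psi> differentiable_on {\<sigma>\<^sub>1..\<sigma>\<^sub>2}"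
    and "t\<^sub>0 = fixed_point_on {\<tau>\<^sub>1..\<tau>\<^sub>2} \<phi>"
    and "s\<^sub>0 = fixed_point_on {\<sigma>\<^sub>1..\<sigma>\<^sub>2} \<psi>"
  shows "\<exists>f. diffeomorphism_on {\<sigma>\<^sub>1..\<sigma>\<^sub>2} {\<tau>\<^sub>1..\<tau>\<^sub>2} f
           \<and> strict_mono_on {\<sigma>\<^sub>1..\<sigma>\<^sub>2} f
           \<and> (\<forall>s\<in>{\<sigma>\<^sub>1..\<sigma>\<^sub>2}. f (\<psi> s) = \<phi> (f s))"
proof -
  define L where "L = \<sigma>\<^sub>2 - \<sigma>\<^sub>1"
  define M where "M = \<tau>\<^sub>2 - \<tau>\<^sub>1"
  define h where "h = (\<lambda>t. t - \<phi> t)"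
  define k where "k = (\<lambda>s. s - \<psi> s)"
  \<comment> \<open>The factor \<open>M / L\<close> stretches \<open>{-L..L}\<close> onto
    \<open>{-M..M}\<close>. Being linear, the scaling commutes with the reflection at 0, to which
    \<open>k\<close> and \<open>h\<close> conjugate \<psi> and \<phi>.\<close>
  define f where "f = inv_into {\<tau>\<^sub>1..\<tau>\<^sub>2} h \<circ> ((\<lambda>x. M / L * x) \<circ> k)"
  have pos: "0 < L" "0 < M"
    using assms(1,2) by (simp_all add: L_def M_def)
  have h: "diffeomorphism_on {\<tau>\<^sub>1..\<tau>\<^sub>2} {-M..M} h" and hmono: "strict_mono_on {\<tau>\<^sub>1..\<tau>\<^sub>2} h"
    unfolding h_def M_def using involution_linearisation assms(1,3,4) by blast+
  have k: "diffeomorphism_on {\<sigma>\<^sub>1..\<sigma>\<^sub>2} {-L..L} k" and kmono: "strict_mono_on {\<sigma>\<^sub>1..\<sigma>\<^sub>2} k"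
    unfolding k_def L_def using involution_linearisation assms(2,5,6) by blast+
  have bij_h: "bij_betw h {\<tau>\<^sub>1..\<tau>\<^sub>2} {-M..M}"
    using h by (simp add: diffeomorphism_on_def)
  have scaled: "diffeomorphism_on {\<sigma>\<^sub>1..\<sigma>\<^sub>2} {-M..M} ((\<lambda>x. M / L * x) \<circ> k)"
  proof (rule diffeomorphism_on_compose[OF k])
    show "diffeomorphism_on {-L..L} {-M..M} (\<lambda>x. M / L * x)"
      using diffeomorphism_on_scale[of "M / L" L] pos by simp
  qed
  then have scaled_in: "M / L * k s \<in> {-M..M}" if "s \<in> {\<sigma>\<^sub>1..\<sigma>\<^sub>2}" for s
    using that by (auto simp: diffeomorphism_on_def dest!: bij_betw_apply)
  have f: "diffeomorphism_on {\<sigma>\<^sub>1..\<sigma>\<^sub>2} {\<tau>\<^sub>1..\<tau>\<^sub>2} f"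
    unfolding f_def by (rule diffeomorphism_on_compose[OF scaled diffeomorphism_on_inv_into[OF h]])
  then have f_in: "f s \<in> {\<tau>\<^sub>1..\<tau>\<^sub>2}" if "s \<in> {\<sigma>\<^sub>1..\<sigma>\<^sub>2}" for s
    using that by (meson bij_betw_apply diffeomorphism_on_def)
  have hf: "h (f s) = M / L * k s" if "s \<in> {\<sigma>\<^sub>1..\<sigma>\<^sub>2}" for s
    using bij_betw_inv_into_right[OF bij_h scaled_in[OF that]] by (simp add: f_def)
  have "strict_mono_on {\<sigma>\<^sub>1..\<sigma>\<^sub>2} f"
  proof (rule strict_mono_onI)
    fix r s assume rs: "r \<in> {\<sigma>\<^sub>1..\<sigma>\<^sub>2}" "s \<in> {\<sigma>\<^sub>1..\<sigma>\<^sub>2}" "r < s"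
    \<comment> \<open>By \<open>hf\<close>, composing with \<open>h\<close> turns \<open>f\<close>
      into a positive multiple of the increasing \<open>k\<close>; the strictly increasing
      \<open>h\<close> then reflects the order.\<close>
    have "h (f r) < h (f s)"
      using strict_mono_onD[OF kmono rs] pos hf rs by (simp add: divide_strict_right_mono)
    then show "f r < f s"
      using strict_mono_on_less[OF hmono] f_in rs by blast
  qed
  moreover have "f (\<psi> s) = \<phi> (f s)" if s: "s \<in> {\<sigma>\<^sub>1..\<sigma>\<^sub>2}" for s
  \<comment> \<open>The equation is checked after applying the injective \<open>h\<close>: both
    sides become \<open>- h (f s)\<close>, since \<psi> changes the sign of \<open>k\<close> and
    \<phi> that of \<open>h\<close>.\<close>
  proof (rule inj_onD[OF bij_betw_imp_inj_on[OF bij_h]])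
    have \<psi>: "\<psi> s \<in> {\<sigma>\<^sub>1..\<sigma>\<^sub>2}" "\<psi> (\<psi> s) = s"
      using assms(5) s by (auto simp: involution_on_def)
    have \<phi>: "\<phi> (f s) \<in> {\<tau>\<^sub>1..\<tau>\<^sub>2}" "\<phi> (\<phi> (f s)) = f s"
      using assms(3) f_in[OF s] by (auto simp: involution_on_def)
    have "h (f (\<psi> s)) = M / L * k (\<psi> s)"
      by (rule hf[OF \<psi>(1)])
    also have "\<dots> = - (M / L * k s)"
      by (simp add: k_def \<psi>(2) algebra_simps)
    also have "\<dots> = - h (f s)"
      by (simp add: hf[OF s])
    also have "\<dots> = h (\<phi> (f s))"
      by (simp add: h_def \<phi>(2))
    finally show "h (f (\<psi> s)) = h (\<phi> (f s))" .
    show "f (\<psi> s) \<in> {\<tau>\<^sub>1..\<tau>\<^sub>2}"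
      by (rule f_in[OF \<psi>(1)])
    show "\<phi> (f s) \<in> {\<tau>\<^sub>1..\<tau>\<^sub>2}"
      by (rule \<phi>(1))
  qed
  ultimately show ?thesis
    using f by blast
qed

end
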